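(* Let $\beta$ be a quadratic Perron number. Then the $\beta$-continued fraction of any $\xi\in\mathbb{Q}(\beta)$ contains at most finitely many partial quotients in $\mathbb{Z}_\beta\setminus\mathbb{Z}$, and thus it is either finite or eventually periodic with all partial quotients in the period being rational integers. In particular, every quadratic Perron number satisfies property (CFP).
   Context: A quadratic Perron number is an algebraic integer $\beta>1$ of degree 2 whose algebraic conjugate $\beta'$ satisfies $|\beta'|<\beta$. $\beta$-integers: for real $\beta>1$, every real $x\ge 0$ has a unique (up to leading zeros) greedy $\beta$-expansion $x=\sum_{i=-\infty}^{k}x_i\beta^i$ with integer digits $0\le x_i<\beta$ such that $\sum_{i=-\infty}^{j}x_i\beta^i<\beta^{j+1}$ for every $j\le k$. The set $\mathbb{Z}_\beta$ of $\beta$-integers consists of all real $x$ such that the greedy $\beta$-expansion of $|x|$ has $x_i=0$ for all $i<0$. $\beta$-continued fraction of $\xi\in\mathbb{R}$: put $\xi_0=\xi$ and, for $n\ge 0$, $a_n=\max\{y\in\mathbb{Z}_\beta: y\le \xi_n\}$; if $\xi_n\in\mathbb{Z}_\beta$ the algorithm stops and the expansion $[a_0,\dots,a_n]$ is finite; otherwise $\xi_{n+1}=1/(\xi_n-a_n)$. If it never stops, the expansion is the infinite sequence $[a_0,a_1,\dotsc]$. The $a_n$ are the partial quotients. Property (CFP): every element of $\mathbb{Q}(\beta)$ has a finite or eventually periodic $\beta$-continued fraction expansion. *)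

theory Defs
  imports "HOL-Analysis.Analysis" "HOL-Computational_Algebra.Computational_Algebra"
begin

definition is_min_poly :: "rat poly \<Rightarrow> real \<Rightarrow> bool" where
  "is_min_poly p x \<longleftrightarrow> lead_coeff p = 1 \<and> irreducible p \<and> poly (map_poly of_rat p) x = 0"

text \<open>Roots of the minimal polynomial are taken in the complex numbers. As the minimal
  polynomial is separable, the roots different from \<open>\<beta>\<close> are exactly the other conjugates;
  in degree 2 there is exactly one.\<close>
definition quadratic_perron :: "real \<Rightarrow> bool" where
  "quadratic_perron \<beta> \<longleftrightarrow> \<beta> > 1 \<and> algebraic_int \<beta> \<and>
     (\<exists>p. is_min_poly p \<beta> \<and> degree p = 2 \<and>
        (\<forall>\<beta>'::complex. poly (map_poly of_rat p) \<beta>' = 0 \<and> \<beta>' \<noteq> of_real \<beta> \<longrightarrow> norm \<beta>' < \<beta>))"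

definition is_subfield :: "real set \<Rightarrow> bool" where
  "is_subfield K \<longleftrightarrow> 0 \<in> K \<and> 1 \<in> K \<and>
     (\<forall>x\<in>K. \<forall>y\<in>K. x + y \<in> K \<and> x * y \<in> K) \<and> (\<forall>x\<in>K. - x \<in> K \<and> inverse x \<in> K)"

text \<open>The field \<open>\<rat>(\<beta>)\<close>; every subfield of the reals contains the rationals.\<close>
definition rat_adjoin :: "real \<Rightarrow> real set" where
  "rat_adjoin \<beta> = \<Inter> {K. is_subfield K \<and> \<beta> \<in> K}"

text \<open>\<open>d i\<close> is the digit at \<open>\<beta>\<close> to the power \<open>i\<close>, for \<open>i \<le> k\<close>; the digits above \<open>k\<close> are \<open>0\<close>.\<close>
definition greedy_expansion :: "real \<Rightarrow> real \<Rightarrow> int \<Rightarrow> (int \<Rightarrow> int) \<Rightarrow> bool" where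
  "greedy_expansion \<beta> x k d \<longleftrightarrow>
     (\<forall>i. 0 \<le> d i \<and> of_int (d i) < \<beta>) \<and> (\<forall>i>k. d i = 0) \<and>
     ((\<lambda>i. of_int (d i) * \<beta> powi i) has_sum x) {..k} \<and>
     (\<forall>j\<le>k. (\<Sum>\<^sub>\<infinity>i\<in>{..j}. of_int (d i) * \<beta> powi i) < \<beta> powi (j + 1))"

definition beta_integers :: "real \<Rightarrow> real set" where
  "beta_integers \<beta> = {x. \<exists>k d. greedy_expansion \<beta> \<bar>x\<bar> k d \<and> (\<forall>i<0. d i = 0)}"

text \<open>The maximum exists for every \<open>\<beta> > 1\<close>, since the \<open>\<beta>\<close>-integers are then locally finite
  and unbounded below.\<close>
definition beta_floor :: "real \<Rightarrow> real \<Rightarrow> real" where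
  "beta_floor \<beta> x = (GREATEST y. y \<in> beta_integers \<beta> \<and> y \<le> x)"

text \<open>The complete quotients \<open>\<xi>\<^sub>n\<close> and partial quotients \<open>a\<^sub>n\<close>, with \<open>None\<close> for every index
  that is not reached because the algorithm has stopped.\<close>
primrec complete_quotient :: "real \<Rightarrow> real \<Rightarrow> nat \<Rightarrow> real option" where
  "complete_quotient \<beta> \<xi> 0 = Some \<xi>"
| "complete_quotient \<beta> \<xi> (Suc n) =
     (case complete_quotient \<beta> \<xi> n of
        None \<Rightarrow> None
      | Some x \<Rightarrow> if x \<in> beta_integers \<beta> then None else Some (1 / (x - beta_floor \<beta> x)))"

definition partial_quotient :: "real \<Rightarrow> real \<Rightarrow> nat \<Rightarrow> real option" where
  "partial_quotient \<beta> \<xi> n = map_option (beta_floor \<beta>) (complete_quotient \<beta> \<xi> n)"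

definition finite_bcf :: "real \<Rightarrow> real \<Rightarrow> bool" where
  "finite_bcf \<beta> \<xi> \<longleftrightarrow> (\<exists>n. partial_quotient \<beta> \<xi> n = None)"

text \<open>The expansion is infinite, and periodic with (not necessarily minimal) period length \<open>p\<close>
  from index \<open>N\<close> on.\<close>
definition bcf_periodic_from :: "real \<Rightarrow> real \<Rightarrow> nat \<Rightarrow> nat \<Rightarrow> bool" where
  "bcf_periodic_from \<beta> \<xi> N p \<longleftrightarrow> \<not> finite_bcf \<beta> \<xi> \<and> p > 0 \<and>
     (\<forall>n\<ge>N. partial_quotient \<beta> \<xi> (n + p) = partial_quotient \<beta> \<xi> n)"

definition CFP :: "real \<Rightarrow> bool" where
  "CFP \<beta> \<longleftrightarrow> (\<forall>\<xi>\<in>rat_adjoin \<beta>. finite_bcf \<beta> \<xi> \<or> (\<exists>N p. bcf_periodic_from \<beta> \<xi> N p))"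

end

theory Submission
  imports Defs
begin

text \<open>
  Write \<open>z \<mapsto> z'\<close> for the conjugation of \<open>\<int>[\<beta>]\<close>. A \<open>\<beta>\<close>-integer is, up to sign, a polynomial in \<open>\<beta>\<close>
  with nonnegative digits, so \<open>\<bar>\<beta>'\<bar> < \<beta>\<close> gives \<open>\<bar>a'\<bar> \<le> \<bar>a\<bar>\<close> for each partial quotient \<open>a\<close>, and the
  inequality is strict unless \<open>a\<close> is a rational integer (\<open>beta_integer_conj_le\<close>,
  \<open>beta_integer_conj_less\<close>).

  Drop the first partial quotient of an infinite expansion, so that none is negative and all after
  the new first one are at least 1. What remains expands \<open>u / d\<close> with \<open>u \<in> \<int>[\<beta>]\<close> and \<open>d > 0\<close> an integer; let
  \<open>p\<^sub>n / q\<^sub>n\<close> be its convergents. The numbers \<open>\<gamma> = d p\<^sub>n - u q\<^sub>n\<close> are nonzero elements of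
  \<open>\<int>[\<beta>]\<close>, of size at most a constant over \<open>q\<^sub>n\<^sub>+\<^sub>1\<close>. Their conjugates satisfy the same recursion
  with the smaller coefficients \<open>a'\<close>, so they are at most a constant times \<open>q\<^sub>n\<close>. Hence the norms
  of the \<open>\<gamma>\<close> are nonzero integers of bounded size. Two consequences follow.

  Every complete quotient is, up to sign, the quotient of two consecutive \<open>\<gamma>\<close>. Making its
  denominator rational exhibits it as an element of \<open>\<int>[\<beta>]\<close>, bounded together with its conjugate,
  divided by a bounded integer. There are only finitely many such numbers
  (\<open>finite_complete_quotients\<close>), so some complete quotient recurs and the expansion is periodic.

  Since norms are at least 1, \<open>\<gamma>'\<close> is not only at most but also at least a constant times \<open>q\<^sub>n\<close>.
  Each partial quotient with \<open>\<bar>a'\<bar> < a\<close> decreases the available upper bound on \<open>\<bar>\<gamma>'\<bar> / q\<^sub>n\<close> by a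
  factor that is bounded away from 1, because only finitely many values of \<open>a\<close> occur. So this
  happens only finitely often (\<open>finitely_many_strictly_dominated\<close>), and the period consists of
  rational integers.
\<close>

section \<open>The minimal polynomial of a quadratic Perron number\<close>

lemma irreducible_quadratic_root_irrational:
  fixes p :: "rat poly" and x :: real
  assumes "irreducible p" "degree p = 2" "poly (map_poly of_rat p) x = 0"
  shows "x \<notin> \<rat>"
proof
  assume "x \<in> \<rat>"
  then obtain r where r: "x = of_rat r" by (auto elim: Rats_cases)
  have "(of_rat (poly p r) :: real) = poly (map_poly of_rat p) (of_rat r)"
    by (simp add: poly_altdef degree_map_poly coeff_map_poly of_rat_sum of_rat_mult of_rat_power)
  then have "poly p r = 0"
    using assms(3) by (simp add: r)
  then obtain q where q: "p = [:-r, 1:] * q"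
    by (auto simp: poly_eq_0_iff_dvd elim: dvdE)
  have "q \<noteq> 0"
    using assms(1) q by auto
  then have "degree p = 1 + degree q"
    by (subst q, subst degree_mult_eq) auto
  then have "degree q = 1"
    using assms(2) by simp
  moreover have "[:-r, 1:] dvd 1 \<or> q dvd 1"
    using assms(1) q by (meson irreducibleD)
  ultimately show False
    using is_unit_iff_degree[OF \<open>q \<noteq> 0\<close>] is_unit_iff_degree[of "[:-r, 1:]"] by auto
qed

lemma poly_of_int_poly_add_mult:
  fixes x :: "'a :: comm_ring_1"
  shows "poly (map_poly of_int (p * q + r)) x
    = poly (map_poly of_int p) x * poly (map_poly of_int q) x + poly (map_poly of_int r) x"
proof -
  have "map_poly of_int (p * q + r) = map_poly of_int p * map_poly of_int q + (map_poly of_int r :: 'a poly)"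
    by (rule poly_eqI) (simp add: coeff_map_poly coeff_mult)
  then show ?thesis by simp
qed

text \<open>Division with remainder stays inside the integer polynomials after multiplication by a power
  of the leading coefficient, and the remainder, having degree below 2, cannot vanish at an
  irrational number unless it is zero. Multiplicativity of the content (Gauss's lemma) then
  removes the power again, so a primitive quadratic polynomial divides the monic polynomial that
  witnesses integrality.\<close>
lemma primitive_quadratic_lead_coeff_unit:
  fixes x :: real and f :: "int poly"
  assumes "algebraic_int x" "x \<notin> \<rat>"
    and f: "content f = 1" "degree f = 2" "poly (map_poly of_int f) x = 0"
  shows "lead_coeff f dvd 1"
proof -
  obtain P where P: "poly (map_poly of_int P) x = 0" "lead_coeff P = 1"
    using assms(1) by (auto simp: algebraic_int_altdef_ipoly)
  have "f \<noteq> 0" using f(2) by auto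
  obtain q r where qr: "pseudo_divmod P f = (q, r)" by force
  define m where "m = lead_coeff f ^ (Suc (degree P) - degree f)"
  have eq: "smult m P = f * q + r" and r: "r = 0 \<or> degree r < 2"
    using pseudo_divmod[OF \<open>f \<noteq> 0\<close> qr] f(2) unfolding m_def by auto
  have "m \<noteq> 0" using \<open>f \<noteq> 0\<close> by (simp add: m_def)
  have "poly (map_poly of_int (f * q + r)) x = (0::real)"
    unfolding eq[symmetric] using P(1) by (simp add: map_poly_smult)
  then have rx: "poly (map_poly of_int r) x = 0"
    using f(3) by (simp add: poly_of_int_poly_add_mult)
  have "degree r \<le> 1" using r by auto
  then have "r = [:coeff r 0, coeff r 1:]"
    by (intro poly_eqI) (auto simp: coeff_pCons coeff_eq_0 split: nat.splits)
  then obtain r0 r1 where r01: "r = [:r0, r1:]" by metis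
  have lin: "of_int r0 + x * of_int r1 = (0::real)"
    using rx by (simp add: r01 map_poly_pCons)
  have "r1 = 0"
  proof (rule ccontr)
    assume "r1 \<noteq> 0"
    then have "x = - of_int r0 / of_int r1"
      using lin by (simp add: field_simps)
    then show False using assms(2) by auto
  qed
  with lin have "r = 0" by (simp add: r01)
  then have eq: "smult m P = f * q" using eq by simp
  have "content P = 1"
    using P(2) content_dvd_coeff[of P "degree P"] by (metis is_unit_normalize normalize_content)
  then have "content q = normalize m"
    using arg_cong[OF eq, of content] f(1) by (simp add: content_mult)
  then have "[:m:] dvd q"
    by (simp add: const_poly_dvd_iff_dvd_content)
  then obtain q' where "q = smult m q'"
    by (auto elim!: dvdE)
  then have "smult m P = smult m (f * q')" using eq by simp
  then have "P = f * q'" using \<open>m \<noteq> 0\<close> by (metis smult_cancel)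
  then have "1 = lead_coeff f * lead_coeff q'"
    using P(2) by (metis lead_coeff_mult)
  then show ?thesis by (rule dvdI)
qed

text \<open>The definition of a quadratic Perron number gives a minimal polynomial over the rationals;
  conjugates and norms in \<open>\<int>[\<beta>]\<close> need integer coefficients.\<close>
lemma quadratic_algebraic_int_equation:
  fixes x :: real and s t :: rat
  assumes "algebraic_int x" "x \<notin> \<rat>" "x\<^sup>2 = of_rat s * x + of_rat t"
  obtains b c :: int where "s = of_int b" "t = of_int c"
proof -
  obtain s1 s2 where s: "s2 > 0" "s = of_int s1 / of_int s2"
    using quotient_of_denom_pos'[of s] quotient_of_div[of s] by (cases "quotient_of s") auto
  obtain t1 t2 where t: "t2 > 0" "t = of_int t1 / of_int t2"
    using quotient_of_denom_pos'[of t] quotient_of_div[of t] by (cases "quotient_of t") auto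
  define g where "g = [: - (t1 * s2), - (s1 * t2), s2 * t2 :]"
  define f where "f = primitive_part g"
  have "g \<noteq> 0" using s(1) t(1) by (simp add: g_def)
  have g: "g = smult (content g) f" by (simp add: f_def)
  have cg: "content g \<noteq> 0" using \<open>g \<noteq> 0\<close> by simp
  have degg: "degree g = 2" using s(1) t(1) by (simp add: g_def)
  have degf: "degree f = 2" using degg g cg by (metis degree_smult_eq)
  have gx: "poly (map_poly of_int g) x = (0::real)"
    using assms(3) s t by (simp add: g_def map_poly_pCons of_rat_divide field_simps power2_eq_square)
  have "poly (map_poly of_int g) x = of_int (content g) * poly (map_poly of_int f) x"
    by (subst g) (simp add: map_poly_smult)
  then have "poly (map_poly of_int f) x = 0"
    using gx cg by simp
  then have "lead_coeff f dvd 1"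
    using primitive_quadratic_lead_coeff_unit assms(1,2) degf \<open>g \<noteq> 0\<close> by (simp add: f_def)
  then have u: "coeff f 2 = 1 \<or> coeff f 2 = -1" using degf by auto
  have co: "coeff g i = content g * coeff f i" for i by (subst g) simp
  have e2: "s2 * t2 = content g * coeff f 2" using co[of 2] by (simp add: g_def numeral_2_eq_2)
  have e1: "- (s1 * t2) = content g * coeff f 1" using co[of 1] by (simp add: g_def)
  have e0: "- (t1 * s2) = content g * coeff f 0" using co[of 0] by (simp add: g_def)
  have "s2 * t2 dvd s1 * t2" "s2 * t2 dvd t1 * s2"
    using u unfolding e2 by (metis dvd_minus_iff e1 dvd_triv_left mult.right_neutral mult_minus_right minus_dvd_iff e0)+
  then have "s2 dvd s1" "t2 dvd t1" using s(1) t(1) by (auto simp: mult.commute[of s2 t2])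
  then obtain k l where "s1 = s2 * k" "t1 = t2 * l" by (auto elim!: dvdE)
  then show ?thesis using that[of k l] s t by simp
qed

section \<open>The order \<open>\<int>[\<beta>]\<close> and its conjugation\<close>

locale quadratic_integer =
  fixes \<beta> :: real and b c :: int
  assumes irrational: "\<beta> \<notin> \<rat>" and equation: "\<beta>\<^sup>2 = of_int b * \<beta> + of_int c"
begin

text \<open>As the sum of the two roots is \<open>b\<close>, this is the other root of the quadratic equation.\<close>
definition \<beta>' :: real where "\<beta>' = of_int b - \<beta>"

definition \<O> :: "real set" where
  "\<O> = {of_int x + of_int y * \<beta> | x y. True}"

definition conj :: "real \<Rightarrow> real" where
  "conj z = (THE w. \<exists>x y::int. z = of_int x + of_int y * \<beta> \<and> w = of_int x + of_int y * \<beta>')"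

lemma equation': "\<beta>'\<^sup>2 = of_int b * \<beta>' + of_int c"
  using equation by (simp add: \<beta>'_def power2_eq_square algebra_simps)

lemma irrational': "\<beta>' \<notin> \<rat>"
proof
  assume "\<beta>' \<in> \<rat>"
  then have "of_int b - \<beta>' \<in> \<rat>" by (intro Rats_diff) auto
  then show False using irrational by (simp add: \<beta>'_def)
qed

lemma conjugates_distinct: "\<beta> \<noteq> \<beta>'"
proof
  assume "\<beta> = \<beta>'"
  then have "\<beta> = of_int b / 2" by (simp add: \<beta>'_def)
  also have "\<dots> \<in> \<rat>" by (intro Rats_divide) auto
  finally show False using irrational by simp
qed

lemma irrational_combination_eq_0:
  fixes x y :: int and z :: real
  assumes "z \<notin> \<rat>" "of_int x + of_int y * z = 0"
  shows "x = 0 \<and> y = 0"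
proof (cases "y = 0")
  case False
  then have "z = - of_int x / of_int y"
    using assms(2) by (simp add: field_simps)
  then show ?thesis using assms(1) by auto
qed (use assms in auto)

lemma coordinates_unique:
  assumes "of_int x + of_int y * \<beta> = of_int x' + of_int y' * \<beta>"
  shows "x = x' \<and> y = y'"
  using irrational_combination_eq_0[OF irrational, of "x - x'" "y - y'"] assms
  by (simp add: algebra_simps)

lemma conj_eq: "conj (of_int x + of_int y * \<beta>) = of_int x + of_int y * \<beta>'"
  unfolding conj_def by (rule the_equality) (use coordinates_unique in blast)+

lemma \<O>_cases [elim?]:
  assumes "z \<in> \<O>"
  obtains x y where "z = of_int x + of_int y * \<beta>" "conj z = of_int x + of_int y * \<beta>'"
  using assms conj_eq by (auto simp: \<O>_def)

lemma \<O>I: "of_int x + of_int y * \<beta> \<in> \<O>"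
  by (auto simp: \<O>_def)

lemma of_int_in_\<O> [simp]: "of_int x \<in> \<O>" and conj_of_int [simp]: "conj (of_int x) = of_int x"
  using \<O>I[of x 0] conj_eq[of x 0] by simp_all

lemma \<beta>_in_\<O> [simp]: "\<beta> \<in> \<O>" and conj_\<beta> [simp]: "conj \<beta> = \<beta>'"
  using \<O>I[of 0 1] conj_eq[of 0 1] by simp_all

lemma
  assumes "z \<in> \<O>" "w \<in> \<O>"
  shows add_in_\<O>: "z + w \<in> \<O>" and conj_add: "conj (z + w) = conj z + conj w"
proof -
  obtain x y where z: "z = of_int x + of_int y * \<beta>" "conj z = of_int x + of_int y * \<beta>'"
    using assms(1) by (rule \<O>_cases)
  obtain x' y' where w: "w = of_int x' + of_int y' * \<beta>" "conj w = of_int x' + of_int y' * \<beta>'"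
    using assms(2) by (rule \<O>_cases)
  have eq: "z + w = of_int (x + x') + of_int (y + y') * \<beta>"
    by (simp add: z(1) w(1) algebra_simps)
  show "z + w \<in> \<O>" unfolding eq by (rule \<O>I)
  show "conj (z + w) = conj z + conj w"
    unfolding eq conj_eq by (simp add: z(2) w(2) algebra_simps)
qed

lemma
  assumes "z \<in> \<O>" "w \<in> \<O>"
  shows mult_in_\<O>: "z * w \<in> \<O>" and conj_mult: "conj (z * w) = conj z * conj w"
proof -
  obtain x y where z: "z = of_int x + of_int y * \<beta>" "conj z = of_int x + of_int y * \<beta>'"
    using assms(1) by (rule \<O>_cases)
  obtain x' y' where w: "w = of_int x' + of_int y' * \<beta>" "conj w = of_int x' + of_int y' * \<beta>'"
    using assms(2) by (rule \<O>_cases)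
  have expand: "(of_int x + of_int y * t) * (of_int x' + of_int y' * t)
        = of_int (x * x' + y * y' * c) + of_int (x * y' + y * x' + y * y' * b) * t"
    if "t\<^sup>2 = of_int b * t + of_int c" for t :: real
  proof -
    have "(of_int x + of_int y * t) * (of_int x' + of_int y' * t)
        = of_int x * of_int x' + (of_int x * of_int y' + of_int y * of_int x') * t
            + of_int y * of_int y' * t\<^sup>2"
      by (simp add: algebra_simps power2_eq_square)
    then show ?thesis unfolding that by (simp add: algebra_simps)
  qed
  have eq: "z * w = of_int (x * x' + y * y' * c) + of_int (x * y' + y * x' + y * y' * b) * \<beta>"
    unfolding z(1) w(1) by (rule expand[OF equation])
  show "z * w \<in> \<O>" unfolding eq by (rule \<O>I)
  show "conj (z * w) = conj z * conj w"
    unfolding eq conj_eq z(2) w(2) by (rule expand[OF equation', symmetric])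
qed

lemma
  assumes "z \<in> \<O>"
  shows uminus_in_\<O>: "- z \<in> \<O>" and conj_uminus: "conj (- z) = - conj z"
  using mult_in_\<O>[OF of_int_in_\<O>[of "-1"] assms] conj_mult[OF of_int_in_\<O>[of "-1"] assms]
  by (simp_all del: conj_of_int add: conj_of_int[of "-1", simplified])

lemma
  assumes "z \<in> \<O>" "w \<in> \<O>"
  shows diff_in_\<O>: "z - w \<in> \<O>" and conj_diff: "conj (z - w) = conj z - conj w"
  using add_in_\<O>[OF assms(1) uminus_in_\<O>[OF assms(2)]] conj_add[OF assms(1) uminus_in_\<O>[OF assms(2)]]
    conj_uminus[OF assms(2)]
  by simp_all

lemma conj_in_\<O>:
  assumes "z \<in> \<O>" shows "conj z \<in> \<O>" and "conj (conj z) = z"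
proof -
  obtain x y where z: "z = of_int x + of_int y * \<beta>" "conj z = of_int x + of_int y * \<beta>'"
    using assms by (rule \<O>_cases)
  have eq: "conj z = of_int (x + y * b) + of_int (- y) * \<beta>"
    by (simp add: z(2) \<beta>'_def algebra_simps)
  show "conj z \<in> \<O>" unfolding eq by (rule \<O>I)
  show "conj (conj z) = z" unfolding eq conj_eq by (simp add: z(1) \<beta>'_def algebra_simps)
qed

lemma norm_int:
  assumes "z \<in> \<O>" obtains m :: int where "z * conj z = of_int m"
proof -
  obtain x y where z: "z = of_int x + of_int y * \<beta>" "conj z = of_int x + of_int y * \<beta>'"
    using assms by (rule \<O>_cases)
  have "\<beta> * \<beta>' = - of_int c"
    using equation by (simp add: \<beta>'_def power2_eq_square algebra_simps)
  moreover have "\<beta> + \<beta>' = of_int b" by (simp add: \<beta>'_def)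
  moreover have "z * conj z = of_int x * of_int x + of_int x * of_int y * (\<beta> + \<beta>')
      + of_int y * of_int y * (\<beta> * \<beta>')"
    by (simp add: z(2)) (simp add: z(1) algebra_simps)
  ultimately have "z * conj z = of_int (x * x + x * y * b - y * y * c)" by simp
  then show ?thesis by (rule that)
qed

lemma conj_eq_0_iff:
  assumes "z \<in> \<O>" shows "conj z = 0 \<longleftrightarrow> z = 0"
proof -
  obtain x y where "z = of_int x + of_int y * \<beta>" "conj z = of_int x + of_int y * \<beta>'"
    using assms by (rule \<O>_cases)
  then show ?thesis
    using irrational_combination_eq_0[OF irrational] irrational_combination_eq_0[OF irrational']
    by (metis add_0 mult_zero_left of_int_0)
qed

lemma norm_ge_1:
  assumes "z \<in> \<O>" "z \<noteq> 0" shows "1 \<le> \<bar>z\<bar> * \<bar>conj z\<bar>"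
proof -
  obtain m :: int where m: "z * conj z = of_int m" using assms(1) by (rule norm_int)
  then have "m \<noteq> 0" using assms conj_eq_0_iff by fastforce
  then have "1 \<le> \<bar>real_of_int m\<bar>" by linarith
  then show ?thesis by (metis abs_mult m)
qed

text \<open>The pair of a number and its conjugate embeds \<open>\<int>[\<beta>]\<close> as a lattice in the plane.\<close>
lemma finite_bounded_conjugates: "finite {z \<in> \<O>. \<bar>z\<bar> \<le> C \<and> \<bar>conj z\<bar> \<le> C}"
proof -
  define B where "B = 2 * C / \<bar>\<beta> - \<beta>'\<bar>"
  define M where "M = max \<lceil>B\<rceil> \<lceil>C + B * \<bar>\<beta>\<bar>\<rceil>"
  have "{z \<in> \<O>. \<bar>z\<bar> \<le> C \<and> \<bar>conj z\<bar> \<le> C} \<subseteq> (\<lambda>(x, y). of_int x + of_int y * \<beta>) ` ({-M..M} \<times> {-M..M})"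
  proof
    fix z assume z: "z \<in> {z \<in> \<O>. \<bar>z\<bar> \<le> C \<and> \<bar>conj z\<bar> \<le> C}"
    then have "z \<in> \<O>" by simp
    then obtain x y where xy: "z = of_int x + of_int y * \<beta>" "conj z = of_int x + of_int y * \<beta>'"
      by (rule \<O>_cases)
    have "\<bar>of_int y\<bar> * \<bar>\<beta> - \<beta>'\<bar> = \<bar>z - conj z\<bar>"
      by (simp add: xy(2)) (simp add: xy(1) flip: abs_mult, simp add: algebra_simps)
    also have "\<dots> \<le> 2 * C" using z by auto
    finally have y: "\<bar>real_of_int y\<bar> \<le> B"
      using conjugates_distinct by (simp add: B_def field_simps)
    have "\<bar>real_of_int x\<bar> \<le> \<bar>z\<bar> + \<bar>of_int y * \<beta>\<bar>" by (simp add: xy(1))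
    also have "\<dots> \<le> C + B * \<bar>\<beta>\<bar>"
      using z y by (intro add_mono) (auto simp: abs_mult intro: mult_right_mono)
    finally have "\<bar>x\<bar> \<le> M" unfolding M_def by linarith
    moreover have "\<bar>y\<bar> \<le> M" using y unfolding M_def by linarith
    ultimately show "z \<in> (\<lambda>(x, y). of_int x + of_int y * \<beta>) ` ({-M..M} \<times> {-M..M})"
      unfolding xy(1) by (intro image_eqI[of _ _ "(x, y)"]) auto
  qed
  then show ?thesis by (rule finite_subset) auto
qed

text \<open>This is \<open>\<rat>(\<beta>)\<close>: a denominator in \<open>\<int>[\<beta>]\<close> can be replaced by its norm, which is a rational
  integer.\<close>
definition frac_\<O> :: "real set" where
  "frac_\<O> = {u / of_int d | u d. u \<in> \<O> \<and> d > 0}"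

lemma frac_\<O>I:
  assumes "u \<in> \<O>" "d \<noteq> 0" shows "u / of_int d \<in> frac_\<O>"
proof (cases "d > 0")
  case False
  then have "u / of_int d = (- u) / of_int (- d)" "- d > 0" using assms(2) by auto
  then show ?thesis unfolding frac_\<O>_def using uminus_in_\<O>[OF assms(1)] by blast
qed (use assms in \<open>auto simp: frac_\<O>_def\<close>)

lemma frac_\<O>_cases:
  assumes "z \<in> frac_\<O>"
  obtains u d where "u \<in> \<O>" "d > 0" "z = u / of_int d"
  using assms by (auto simp: frac_\<O>_def)

lemma \<O>_subset_frac: "z \<in> \<O> \<Longrightarrow> z \<in> frac_\<O>"
  using frac_\<O>I[of z 1] by simp

lemma subfield_frac_\<O>: "is_subfield frac_\<O>"
  unfolding is_subfield_def
proof (intro conjI ballI)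
  show "0 \<in> frac_\<O>" "1 \<in> frac_\<O>"
    using \<O>_subset_frac[OF of_int_in_\<O>[of 0]] \<O>_subset_frac[OF of_int_in_\<O>[of 1]] by simp_all
next
  fix z w assume "z \<in> frac_\<O>" "w \<in> frac_\<O>"
  then obtain u d u' d' where z: "u \<in> \<O>" "d > 0" "z = u / of_int d"
    and w: "u' \<in> \<O>" "d' > 0" "w = u' / of_int d'"
    by (auto elim!: frac_\<O>_cases)
  have "z + w = (u * of_int d' + u' * of_int d) / of_int (d * d')"
    using z w by (simp add: field_simps)
  moreover have "u * of_int d' + u' * of_int d \<in> \<O>"
    using z w by (intro add_in_\<O> mult_in_\<O>) auto
  ultimately show "z + w \<in> frac_\<O>" using frac_\<O>I z w by (metis mult_pos_pos less_irrefl)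
  have "z * w = (u * u') / of_int (d * d')" using z w by simp
  then show "z * w \<in> frac_\<O>" using frac_\<O>I mult_in_\<O> z w by (metis mult_pos_pos less_irrefl)
next
  fix z assume "z \<in> frac_\<O>"
  then obtain u d where z: "u \<in> \<O>" "d > 0" "z = u / of_int d" by (rule frac_\<O>_cases)
  then have "- z = (- u) / of_int d" by simp
  then show "- z \<in> frac_\<O>" using frac_\<O>I[of "- u" d] uminus_in_\<O> z by simp
  obtain m :: int where m: "u * conj u = of_int m" using z(1) by (rule norm_int)
  show "inverse z \<in> frac_\<O>"
  proof (cases "u = 0")
    case True
    then show ?thesis using z \<O>_subset_frac[OF of_int_in_\<O>[of 0]] by simp
  next
    case False
    then have "conj u \<noteq> 0" using conj_eq_0_iff z(1) by simp
    then have "m \<noteq> 0" using False m by auto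
    have "inverse z = (of_int d * conj u) / (u * conj u)"
      unfolding z(3) using False \<open>conj u \<noteq> 0\<close> by simp
    also have "\<dots> \<in> frac_\<O>"
      unfolding m using z(1) conj_in_\<O>(1) \<open>m \<noteq> 0\<close> by (intro frac_\<O>I mult_in_\<O>) auto
    finally show ?thesis .
  qed
qed

lemma rat_adjoin_subset: "rat_adjoin \<beta> \<subseteq> frac_\<O>"
  unfolding rat_adjoin_def using subfield_frac_\<O> \<O>_subset_frac[OF \<beta>_in_\<O>] by blast

end

section \<open>\<open>\<beta>\<close>-integers for an arbitrary base\<close>

lemma has_sum_powi_nonneg_digits:
  fixes d :: "int \<Rightarrow> int" and \<beta> :: real
  assumes "\<And>i. i < 0 \<Longrightarrow> d i = 0"
  shows "((\<lambda>i. of_int (d i) * \<beta> powi i) has_sum (\<Sum>i<nat (j + 1). of_int (d (int i)) * \<beta> ^ i)) {..j}"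
proof -
  let ?f = "\<lambda>i. of_int (d i) * \<beta> powi i"
  have "(?f has_sum sum ?f (int ` {..<nat (j + 1)})) (int ` {..<nat (j + 1)})"
    by (rule has_sum_finite) auto
  also have "sum ?f (int ` {..<nat (j + 1)}) = (\<Sum>i<nat (j + 1). of_int (d (int i)) * \<beta> ^ i)"
    by (subst sum.reindex) auto
  finally have 1: "(?f has_sum (\<Sum>i<nat (j + 1). of_int (d (int i)) * \<beta> ^ i)) (int ` {..<nat (j + 1)})" .
  have "int ` {..<nat (j + 1)} = {0..j}"
    by (auto simp: image_iff intro!: bexI[of _ "nat _"])
  with 1 show ?thesis
    using assms by (subst has_sum_cong_neutral[of "{0..j}" _ ?f]) auto
qed

lemma beta_integer_digits:
  assumes "x \<in> beta_integers \<beta>"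
  obtains n and d :: "nat \<Rightarrow> int"
  where "\<bar>x\<bar> = (\<Sum>i<n. of_int (d i) * \<beta> ^ i)" "\<And>i. 0 \<le> d i"
proof -
  obtain k d where g: "greedy_expansion \<beta> \<bar>x\<bar> k d" and d: "\<And>i. i < 0 \<Longrightarrow> d i = 0"
    using assms by (auto simp: beta_integers_def)
  have "\<bar>x\<bar> = (\<Sum>i<nat (k + 1). of_int (d (int i)) * \<beta> ^ i)"
    using g has_sum_powi_nonneg_digits[of d \<beta> k, OF d] has_sum_unique
    by (auto simp: greedy_expansion_def)
  then show ?thesis using that g by (simp add: greedy_expansion_def)
qed

lemma beta_integerI:
  fixes d :: "nat \<Rightarrow> int" and \<beta> :: real
  assumes "\<beta> > 1" "\<And>i. i < n \<Longrightarrow> 0 \<le> d i \<and> of_int (d i) < \<beta>"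
    and "\<And>j. j \<le> n \<Longrightarrow> (\<Sum>i<j. of_int (d i) * \<beta> ^ i) < \<beta> ^ j"
  shows "(\<Sum>i<n. of_int (d i) * \<beta> ^ i) \<in> beta_integers \<beta>"
proof -
  define d' where "d' i = (if 0 \<le> i \<and> i < int n then d (nat i) else 0)" for i
  let ?x = "\<Sum>i<n. of_int (d i) * \<beta> ^ i"
  have d'neg: "d' i = 0" if "i < 0" for i using that by (simp add: d'_def)
  have d'_sum: "(\<Sum>i<m. of_int (d' (int i)) * \<beta> ^ i) = (\<Sum>i<m. of_int (d i) * \<beta> ^ i)" if "m \<le> n" for m
    using that by (intro sum.cong) (auto simp: d'_def)
  have sums: "((\<lambda>i. of_int (d' i) * \<beta> powi i) has_sum (\<Sum>i<nat (j + 1). of_int (d i) * \<beta> ^ i)) {..j}"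
    if "j \<le> int n - 1" for j
    using has_sum_powi_nonneg_digits[of d' \<beta> j, OF d'neg] d'_sum[of "nat (j + 1)"] that by simp
  have "?x \<ge> 0" using assms by (intro sum_nonneg) auto
  have "greedy_expansion \<beta> ?x (int n - 1) d'"
    unfolding greedy_expansion_def
  proof (intro conjI allI impI)
    fix i show "0 \<le> d' i" "of_int (d' i) < \<beta>"
      using assms(1) assms(2)[of "nat i"] by (auto simp: d'_def)
  next
    fix i assume "int n - 1 < i" then show "d' i = 0" by (simp add: d'_def)
  next
    show "((\<lambda>i. of_int (d' i) * \<beta> powi i) has_sum ?x) {..int n - 1}"
      using sums[of "int n - 1"] by simp
  next
    fix j assume j: "j \<le> int n - 1"
    have "(\<Sum>i<nat (j + 1). of_int (d i) * \<beta> ^ i) < \<beta> powi (j + 1)"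
    proof (cases "j + 1 \<ge> 0")
      case True
      then have "\<beta> powi (j + 1) = \<beta> ^ nat (j + 1)"
        by (simp add: power_int_def)
      then show ?thesis using assms(3)[of "nat (j + 1)"] j by simp
    qed (use assms(1) in simp)
    then show "(\<Sum>\<^sub>\<infinity>i\<in>{..j}. of_int (d' i) * \<beta> powi i) < \<beta> powi (j + 1)"
      using infsumI[OF sums[OF j]] by simp
  qed
  then show ?thesis using \<open>?x \<ge> 0\<close> d'neg by (auto simp: beta_integers_def)
qed

lemma beta_integers_0_1:
  assumes "\<beta> > 1" shows "0 \<in> beta_integers \<beta>" "1 \<in> beta_integers \<beta>"
proof -
  show "0 \<in> beta_integers \<beta>"
    using beta_integerI[of \<beta> 0] assms by simp
  show "1 \<in> beta_integers \<beta>"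
    using beta_integerI[of \<beta> 1 "\<lambda>_. 1"] assms by (force simp: le_Suc_eq)
qed

lemma beta_integers_uminus_iff: "- x \<in> beta_integers \<beta> \<longleftrightarrow> x \<in> beta_integers \<beta>"
  by (simp add: beta_integers_def)

text \<open>The greedy algorithm takes the top digit first; stopped after the digit at \<open>\<beta> ^ 0\<close>, it leaves a
  remainder below 1.\<close>
lemma greedy_digits:
  fixes x \<beta> :: real
  assumes "\<beta> > 1" "0 \<le> x" "x < \<beta> ^ n"
  shows "\<exists>d :: nat \<Rightarrow> int. (\<forall>i<n. 0 \<le> d i \<and> of_int (d i) < \<beta>)
    \<and> (\<forall>j\<le>n. (\<Sum>i<j. of_int (d i) * \<beta> ^ i) < \<beta> ^ j)
    \<and> (\<Sum>i<n. of_int (d i) * \<beta> ^ i) \<le> x \<and> x < (\<Sum>i<n. of_int (d i) * \<beta> ^ i) + 1"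
  using assms(2,3)
proof (induction n arbitrary: x)
  case 0
  then show ?case by simp
next
  case (Suc n)
  define q where "q = \<lfloor>x / \<beta> ^ n\<rfloor>"
  define r where "r = x - of_int q * \<beta> ^ n"
  have pos: "\<beta> ^ n > 0" using assms(1) by simp
  have "0 \<le> q" unfolding q_def using Suc.prems pos by simp
  have "x / \<beta> ^ n < \<beta>" using Suc.prems pos by (simp add: field_simps)
  then have "of_int q < \<beta>" unfolding q_def by linarith
  have "of_int q \<le> x / \<beta> ^ n" "x / \<beta> ^ n < of_int q + 1" unfolding q_def by linarith+
  then have "0 \<le> r" "r < \<beta> ^ n" using pos by (simp_all add: r_def field_simps)
  from Suc.IH[OF this] obtain d :: "nat \<Rightarrow> int" where d:
    "\<forall>i<n. 0 \<le> d i \<and> of_int (d i) < \<beta>"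
    "\<forall>j\<le>n. (\<Sum>i<j. of_int (d i) * \<beta> ^ i) < \<beta> ^ j"
    "(\<Sum>i<n. of_int (d i) * \<beta> ^ i) \<le> r" "r < (\<Sum>i<n. of_int (d i) * \<beta> ^ i) + 1"
    by blast
  define e where "e = d(n := q)"
  have low: "(\<Sum>i<j. of_int (e i) * \<beta> ^ i) = (\<Sum>i<j. of_int (d i) * \<beta> ^ i)" if "j \<le> n" for j
    using that by (intro sum.cong) (auto simp: e_def)
  have top: "(\<Sum>i<Suc n. of_int (e i) * \<beta> ^ i) = (\<Sum>i<n. of_int (d i) * \<beta> ^ i) + of_int q * \<beta> ^ n"
    using low[of n] by (simp add: e_def)
  show ?case
  proof (intro exI[of _ e] conjI allI impI)
    fix i assume "i < Suc n"
    then show "0 \<le> e i" "of_int (e i) < \<beta>"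
      using d(1) \<open>0 \<le> q\<close> \<open>of_int q < \<beta>\<close> by (auto simp: e_def less_Suc_eq)
  next
    fix j assume "j \<le> Suc n"
    then consider "j \<le> n" | "j = Suc n" by linarith
    then show "(\<Sum>i<j. of_int (e i) * \<beta> ^ i) < \<beta> ^ j"
    proof cases
      case 1 then show ?thesis using d(2) low by simp
    next
      case 2 then show ?thesis using d(3) Suc.prems(2) unfolding r_def 2 top by linarith
    qed
  qed (use d(3,4) in \<open>unfold top r_def, linarith+\<close>)
qed

lemma beta_integer_just_below:
  fixes x \<beta> :: real
  assumes "\<beta> > 1" "0 \<le> x"
  obtains m where "m \<in> beta_integers \<beta>" "0 \<le> m" "m \<le> x" "x < m + 1"
proof -
  obtain n where "x < \<beta> ^ n" using real_arch_pow[OF assms(1)] by blast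
  from greedy_digits[OF assms this] obtain d :: "nat \<Rightarrow> int" where d:
    "\<forall>i<n. 0 \<le> d i \<and> of_int (d i) < \<beta>"
    "\<forall>j\<le>n. (\<Sum>i<j. of_int (d i) * \<beta> ^ i) < \<beta> ^ j"
    "(\<Sum>i<n. of_int (d i) * \<beta> ^ i) \<le> x" "x < (\<Sum>i<n. of_int (d i) * \<beta> ^ i) + 1"
    by blast
  show ?thesis
  proof (rule that[OF _ _ d(3,4)])
    show "(\<Sum>i<n. of_int (d i) * \<beta> ^ i) \<in> beta_integers \<beta>"
      using d by (intro beta_integerI assms) auto
    show "0 \<le> (\<Sum>i<n. of_int (d i) * \<beta> ^ i)"
      using d(1) assms(1) by (intro sum_nonneg) auto
  qed
qed

section \<open>\<open>\<beta>\<close>-integers for a quadratic Perron base\<close>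

locale quadratic_perron_integer = quadratic_integer +
  assumes base_gt_1: "\<beta> > 1" and conj_dominated: "\<bar>\<beta>'\<bar> < \<beta>"
begin

lemma digit_sum_conj:
  fixes d :: "nat \<Rightarrow> int"
  shows "(\<Sum>i<n. of_int (d i) * \<beta> ^ i) \<in> \<O>
    \<and> conj (\<Sum>i<n. of_int (d i) * \<beta> ^ i) = (\<Sum>i<n. of_int (d i) * \<beta>' ^ i)"
proof (induction n)
  case 0
  show ?case using of_int_in_\<O>[of 0] conj_of_int[of 0] by simp
next
  case (Suc n)
  have pow: "\<beta> ^ k \<in> \<O> \<and> conj (\<beta> ^ k) = \<beta>' ^ k" for k
  proof (induction k)
    case 0
    show ?case using of_int_in_\<O>[of 1] conj_of_int[of 1] by simp
  qed (simp add: mult_in_\<O> conj_mult)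
  then show ?case
    using Suc by (simp add: add_in_\<O> mult_in_\<O> conj_add conj_mult)
qed

text \<open>The digits are nonnegative and all powers of \<open>\<beta>'\<close> from the first on are strictly smaller in
  absolute value than those of \<open>\<beta>\<close>; so equality forces the expansion to consist of the digit
  \<open>d 0\<close> alone.\<close>
lemma digit_sum_conj_less:
  fixes d :: "nat \<Rightarrow> int" and n :: nat
  assumes "\<And>i. 0 \<le> d i"
  defines "x \<equiv> \<Sum>i<n. of_int (d i) * \<beta> ^ i"
  shows "\<bar>conj x\<bar> \<le> x" and "x \<notin> \<int> \<Longrightarrow> \<bar>conj x\<bar> < x"
proof -
  have term_le: "\<bar>of_int (d i) * \<beta>' ^ i\<bar> \<le> of_int (d i) * \<beta> ^ i" for i
    using assms(1)[of i] conj_dominated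
    by (auto simp: abs_mult power_abs intro!: mult_left_mono power_mono)
  have "\<bar>conj x\<bar> \<le> (\<Sum>i<n. \<bar>of_int (d i) * \<beta>' ^ i\<bar>)"
    using digit_sum_conj[of d n] sum_abs unfolding x_def by metis
  also have "\<dots> \<le> x" unfolding x_def by (rule sum_mono) (rule term_le)
  finally show "\<bar>conj x\<bar> \<le> x" .
  assume "x \<notin> \<int>"
  \<comment> \<open>A number that is not a rational integer has a nonzero digit at a positive power.\<close>
  have "\<exists>i<n. i > 0 \<and> d i \<noteq> 0"
  proof (rule ccontr)
    assume "\<not> ?thesis"
    then have "of_int (d i) * \<beta> ^ i \<in> \<int>" if "i < n" for i
      using that by (cases "i = 0") auto
    then have "x \<in> \<int>" unfolding x_def by (intro Ints_sum) auto
    with \<open>x \<notin> \<int>\<close> show False by simp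
  qed
  then obtain i where i: "i < n" "i > 0" "d i \<noteq> 0" by blast
  have "\<bar>\<beta>'\<bar> ^ i < \<beta> ^ i" using i conj_dominated by (intro power_strict_mono) auto
  then have "\<bar>of_int (d i) * \<beta>' ^ i\<bar> < of_int (d i) * \<beta> ^ i"
    using i assms(1)[of i] by (simp add: abs_mult power_abs)
  then have "(\<Sum>i<n. \<bar>of_int (d i) * \<beta>' ^ i\<bar>) < x"
    unfolding x_def using i(1) term_le by (intro sum_strict_mono_ex1) auto
  moreover have "\<bar>conj x\<bar> \<le> (\<Sum>i<n. \<bar>of_int (d i) * \<beta>' ^ i\<bar>)"
    using digit_sum_conj[of d n] sum_abs unfolding x_def by metis
  ultimately show "\<bar>conj x\<bar> < x" by linarith
qed

lemma
  assumes "x \<in> beta_integers \<beta>"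
  shows beta_integer_in_\<O>: "x \<in> \<O>"
    and beta_integer_conj_le: "\<bar>conj x\<bar> \<le> \<bar>x\<bar>"
    and beta_integer_conj_less: "x \<notin> \<int> \<Longrightarrow> \<bar>conj x\<bar> < \<bar>x\<bar>"
proof -
  obtain n and d :: "nat \<Rightarrow> int" where d: "\<bar>x\<bar> = (\<Sum>i<n. of_int (d i) * \<beta> ^ i)" "\<And>i. 0 \<le> d i"
    using beta_integer_digits[OF assms] by metis
  have abs: "\<bar>x\<bar> \<in> \<O>" using digit_sum_conj[of d n] d(1) by simp
  have x: "x = \<bar>x\<bar> \<or> x = - \<bar>x\<bar>" by linarith
  then show "x \<in> \<O>" using abs uminus_in_\<O> by metis
  have c: "\<bar>conj x\<bar> = \<bar>conj \<bar>x\<bar>\<bar>" using x conj_uminus[OF abs] by (metis abs_minus_cancel)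
  show "\<bar>conj x\<bar> \<le> \<bar>x\<bar>" using digit_sum_conj_less(1)[of d n] d c by simp
  assume "x \<notin> \<int>"
  then have "\<bar>x\<bar> \<notin> \<int>" by (simp add: abs_if)
  then show "\<bar>conj x\<bar> < \<bar>x\<bar>" using digit_sum_conj_less(2)[of d n] d c by simp
qed

text \<open>A bound on a \<open>\<beta>\<close>-integer is also a bound on its conjugate, so the lattice argument applies.\<close>
lemma finite_bounded_beta_integers: "finite {y \<in> beta_integers \<beta>. \<bar>y\<bar> \<le> C}"
  by (rule finite_subset[OF _ finite_bounded_conjugates[of C]])
     (use beta_integer_in_\<O> beta_integer_conj_le in force)

text \<open>The maximum in the definition of the floor is attained because the \<open>\<beta>\<close>-integers are locally
  finite, and, being symmetric, unbounded below.\<close>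
lemma
  shows beta_floor_in: "beta_floor \<beta> x \<in> beta_integers \<beta>"
    and beta_floor_le: "beta_floor \<beta> x \<le> x"
    and beta_floor_greatest: "y \<in> beta_integers \<beta> \<Longrightarrow> y \<le> x \<Longrightarrow> y \<le> beta_floor \<beta> x"
proof -
  obtain m where m: "m \<in> beta_integers \<beta>" "\<bar>x\<bar> + 1 < m + 1"
    using beta_integer_just_below[OF base_gt_1, of "\<bar>x\<bar> + 1"] by auto
  \<comment> \<open>A \<open>\<beta>\<close>-integer below \<open>x\<close> cuts the candidates down to a finite nonempty set.\<close>
  define S where "S = {y \<in> beta_integers \<beta>. - m \<le> y \<and> y \<le> x}"
  have "- m \<in> S" using m by (auto simp: S_def beta_integers_uminus_iff)
  have "finite S"
    by (rule finite_subset[OF _ finite_bounded_beta_integers[of m]]) (use m in \<open>auto simp: S_def\<close>)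
  have Max_in: "Max S \<in> S" using \<open>finite S\<close> \<open>- m \<in> S\<close> by (intro Max_in) auto
  have greatest: "y \<le> Max S" if "y \<in> beta_integers \<beta>" "y \<le> x" for y
  proof (cases "- m \<le> y")
    case True then show ?thesis using that \<open>finite S\<close> by (intro Max_ge) (auto simp: S_def)
  next
    case False then show ?thesis using Max_in by (auto simp: S_def)
  qed
  have "beta_floor \<beta> x = Max S"
    unfolding beta_floor_def using Max_in greatest by (intro Greatest_equality) (auto simp: S_def)
  then show "beta_floor \<beta> x \<in> beta_integers \<beta>" "beta_floor \<beta> x \<le> x"
    "y \<in> beta_integers \<beta> \<Longrightarrow> y \<le> x \<Longrightarrow> y \<le> beta_floor \<beta> x"
    using Max_in greatest by (auto simp: S_def)
qed

lemma beta_floor_gap: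
  assumes "0 \<le> x" shows "x < beta_floor \<beta> x + 1"
proof -
  obtain m where "m \<in> beta_integers \<beta>" "m \<le> x" "x < m + 1"
    using beta_integer_just_below[OF base_gt_1 assms] by blast
  then show ?thesis using beta_floor_greatest[of m x] by linarith
qed

end

section \<open>Continued fractions over \<open>\<int>[\<beta>]\<close> with dominated conjugates\<close>

text \<open>The recursion of the numerators and denominators of the convergents, with free initial values.\<close>
fun continuant :: "(nat \<Rightarrow> real) \<Rightarrow> real \<Rightarrow> real \<Rightarrow> nat \<Rightarrow> real" where
  "continuant a s t 0 = s"
| "continuant a s t (Suc 0) = t"
| "continuant a s t (Suc (Suc n)) = a (Suc n) * continuant a s t (Suc n) + continuant a s t n"

text \<open>The \<open>a n\<close> are the partial quotients and the \<open>y n\<close> the complete quotients of an infinite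
  continued fraction of \<open>u / d\<close>. Domination of the conjugates is the property of \<open>\<beta>\<close>-integers that
  keeps the norms of the \<open>\<gamma>\<close> below bounded.\<close>
locale dominated_continued_fraction = quadratic_integer +
  fixes a y :: "nat \<Rightarrow> real" and u :: real and d :: int
  assumes a_in_\<O>: "a n \<in> \<O>" and conj_a_le: "\<bar>conj (a n)\<bar> \<le> a n" and a_ge_1: "a (Suc n) \<ge> 1"
    and y_pos: "y n > 0" and y_step: "y n = a n + 1 / y (Suc n)"
    and u_in_\<O>: "u \<in> \<O>" and d_pos: "d > 0" and y_0: "y 0 = u / of_int d"
begin

text \<open>In terms of the convergents \<open>p\<^sub>n / q\<^sub>n\<close>, where \<open>p\<^sub>-\<^sub>1 = 1\<close> and \<open>q\<^sub>-\<^sub>1 = 0\<close>, the value at index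
  \<open>n\<close> is \<open>d * p\<^sub>n\<^sub>-\<^sub>1 - u * q\<^sub>n\<^sub>-\<^sub>1\<close>.\<close>
definition \<gamma> :: "nat \<Rightarrow> real" where
  "\<gamma> = continuant a (of_int d) (of_int d * a 0 - u)"

text \<open>\<open>T\<close> takes the place of the denominators \<open>q\<^sub>n\<^sub>-\<^sub>1\<close>. It grows like them, and the initial values 1
  make it positive and nondecreasing from index 0 on.\<close>
definition T :: "nat \<Rightarrow> real" where
  "T = continuant a 1 1"

definition D :: real where
  "D = \<bar>\<gamma> 0\<bar> + \<bar>\<gamma> 1\<bar>"

definition K :: real where
  "K = max \<bar>conj (\<gamma> 0)\<bar> \<bar>conj (\<gamma> 1)\<bar>"

lemma \<gamma>_rec: "\<gamma> (Suc (Suc n)) = a (Suc n) * \<gamma> (Suc n) + \<gamma> n"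
  and T_rec: "T (Suc (Suc n)) = a (Suc n) * T (Suc n) + T n"
  by (simp_all add: \<gamma>_def T_def)

lemma \<gamma>_in_\<O>: "\<gamma> n \<in> \<O>"
proof (induction n rule: induct_nat_012)
  case 0 show ?case by (simp add: \<gamma>_def)
next
  case 1 show ?case
    using diff_in_\<O>[OF mult_in_\<O>[OF of_int_in_\<O> a_in_\<O>] u_in_\<O>] by (simp add: \<gamma>_def)
next
  case (ge2 n) then show ?case
    unfolding \<gamma>_rec by (intro add_in_\<O> mult_in_\<O> a_in_\<O>)
qed

lemma conj_\<gamma>_rec: "conj (\<gamma> (Suc (Suc n))) = conj (a (Suc n)) * conj (\<gamma> (Suc n)) + conj (\<gamma> n)"
  unfolding \<gamma>_rec by (simp add: conj_add conj_mult mult_in_\<O> a_in_\<O> \<gamma>_in_\<O>)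

lemma \<gamma>_Suc: "\<gamma> (Suc n) = - \<gamma> n / y (Suc n)"
proof (induction n)
  case 0
  have "of_int d * y 0 = u" using y_0 d_pos by simp
  then have "\<gamma> (Suc 0) = of_int d * (a 0 - y 0)" by (simp add: \<gamma>_def right_diff_distrib)
  moreover have "\<gamma> 0 = of_int d" by (simp add: \<gamma>_def)
  ultimately show ?case using y_step[of 0] by simp
next
  case (Suc n)
  have "\<gamma> n = - \<gamma> (Suc n) * y (Suc n)"
    using Suc y_pos[of "Suc n"] by (simp add: field_simps)
  then have "\<gamma> (Suc (Suc n)) = \<gamma> (Suc n) * (a (Suc n) - y (Suc n))"
    by (simp add: \<gamma>_rec algebra_simps)
  then show ?case using y_step[of "Suc n"] by simp
qed

lemma \<gamma>_nonzero: "\<gamma> n \<noteq> 0"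
proof (induction n)
  case 0 show ?case using d_pos by (simp add: \<gamma>_def)
next
  case (Suc n) then show ?case using \<gamma>_Suc[of n] y_pos[of "Suc n"] by simp
qed

lemma T_ge_1: "T n \<ge> 1"
proof (induction n rule: induct_nat_012)
  case (ge2 n)
  have "a (Suc n) * T (Suc n) \<ge> 0" using a_ge_1[of n] ge2 by simp
  then show ?case using ge2 unfolding T_rec by linarith
qed (simp_all add: T_def)

lemma T_mono_Suc: "T n \<le> T (Suc n)"
proof (cases n)
  case (Suc m)
  have "1 * T (Suc m) \<le> a (Suc m) * T (Suc m)"
    using a_ge_1 T_ge_1[of "Suc m"] by (intro mult_right_mono) auto
  then show ?thesis using T_ge_1[of m] unfolding Suc T_rec by linarith
qed (simp add: T_def)

text \<open>The signs of \<open>\<gamma>\<close> alternate and the recursion of \<open>T\<close> has the same coefficients, so this is the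
  determinant identity for two solutions of one linear recursion.\<close>
lemma \<gamma>_T_invariant: "\<bar>\<gamma> n\<bar> * T (Suc n) + \<bar>\<gamma> (Suc n)\<bar> * T n = D"
proof (induction n)
  case 0 show ?case by (simp add: D_def T_def)
next
  case (Suc n)
  have 1: "\<bar>\<gamma> n\<bar> = \<bar>\<gamma> (Suc n)\<bar> * y (Suc n)"
    using \<gamma>_Suc[of n] y_pos[of "Suc n"] by (simp add: abs_divide)
  have 2: "\<bar>\<gamma> (Suc (Suc n))\<bar> = \<bar>\<gamma> (Suc n)\<bar> * (1 / y (Suc (Suc n)))"
    using \<gamma>_Suc[of "Suc n"] y_pos[of "Suc (Suc n)"] by (simp add: abs_divide)
  have "\<bar>\<gamma> (Suc n)\<bar> * T (Suc (Suc n)) + \<bar>\<gamma> (Suc (Suc n))\<bar> * T (Suc n)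
      = \<bar>\<gamma> (Suc n)\<bar> * ((a (Suc n) + 1 / y (Suc (Suc n))) * T (Suc n) + T n)"
    unfolding 2 T_rec by (simp add: algebra_simps)
  also have "\<dots> = \<bar>\<gamma> n\<bar> * T (Suc n) + \<bar>\<gamma> (Suc n)\<bar> * T n"
    unfolding y_step[symmetric] 1 by (simp add: algebra_simps)
  finally show ?case using Suc by simp
qed

lemma \<gamma>_T_le: "\<bar>\<gamma> n\<bar> * T (Suc n) \<le> D"
proof -
  have "0 \<le> \<bar>\<gamma> (Suc n)\<bar> * T n" using T_ge_1[of n] by simp
  then show ?thesis using \<gamma>_T_invariant[of n] by linarith
qed

lemma D_pos: "D > 0"
  using \<gamma>_nonzero[of 0] by (simp add: D_def)

lemma K_nonneg: "K \<ge> 0"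
  by (simp add: K_def)

text \<open>Since \<open>T\<close> satisfies the recursion with the larger coefficients \<open>a\<close> in place of \<open>conj a\<close>, a
  bound by a multiple of \<open>T\<close> propagates from two consecutive indices to all later ones.\<close>
lemma conj_\<gamma>_majorant:
  assumes "\<bar>conj (\<gamma> m)\<bar> \<le> C * T m" "\<bar>conj (\<gamma> (Suc m))\<bar> \<le> C * T (Suc m)" "m \<le> n"
  shows "\<bar>conj (\<gamma> n)\<bar> \<le> C * T n"
proof -
  have "\<bar>conj (\<gamma> (m + k))\<bar> \<le> C * T (m + k)" for k
  proof (induction k rule: induct_nat_012)
    case (ge2 k)
    let ?n = "m + k"
    have "\<bar>conj (\<gamma> (Suc (Suc ?n)))\<bar> \<le> \<bar>conj (a (Suc ?n))\<bar> * \<bar>conj (\<gamma> (Suc ?n))\<bar> + \<bar>conj (\<gamma> ?n)\<bar>"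
      unfolding conj_\<gamma>_rec by (metis abs_mult abs_triangle_ineq)
    also have "\<dots> \<le> a (Suc ?n) * (C * T (Suc ?n)) + C * T ?n"
      using ge2 conj_a_le[of "Suc ?n"] a_ge_1[of ?n] by (intro add_mono mult_mono) auto
    also have "\<dots> = C * T (Suc (Suc ?n))" by (simp add: T_rec algebra_simps)
    finally show ?case by simp
  qed (use assms in simp_all)
  from this[of "n - m"] show ?thesis using assms(3) by simp
qed

lemma conj_\<gamma>_le: "\<bar>conj (\<gamma> n)\<bar> \<le> K * T n"
  by (rule conj_\<gamma>_majorant[of 0]) (auto simp: K_def T_def)

text \<open>A nonzero element of \<open>\<int>[\<beta>]\<close> has norm at least 1 in absolute value; as \<open>\<gamma> n\<close> itself is of
  size \<open>1 / T\<close>, its conjugate must be of size \<open>T\<close>.\<close>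
lemma conj_\<gamma>_ge: "T n \<le> D * \<bar>conj (\<gamma> n)\<bar>"
proof -
  have "T n * 1 \<le> T (Suc n) * (\<bar>\<gamma> n\<bar> * \<bar>conj (\<gamma> n)\<bar>)"
    using T_mono_Suc[of n] T_ge_1[of "Suc n"] norm_ge_1[OF \<gamma>_in_\<O> \<gamma>_nonzero]
    by (intro mult_mono) auto
  also have "\<dots> = (\<bar>\<gamma> n\<bar> * T (Suc n)) * \<bar>conj (\<gamma> n)\<bar>" by simp
  also have "\<dots> \<le> D * \<bar>conj (\<gamma> n)\<bar>" using \<gamma>_T_le by (intro mult_right_mono) auto
  finally show ?thesis by simp
qed

lemma \<gamma>_conj_\<gamma>_le:
  assumes "m \<le> Suc n" shows "\<bar>\<gamma> n\<bar> * \<bar>conj (\<gamma> m)\<bar> \<le> D * K"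
proof -
  have "T m \<le> T (Suc n)" using T_mono_Suc assms by (rule lift_Suc_mono_le)
  then have "\<bar>conj (\<gamma> m)\<bar> \<le> K * T (Suc n)"
    using conj_\<gamma>_le[of m] K_nonneg by (meson mult_left_mono order_trans)
  then have "\<bar>\<gamma> n\<bar> * \<bar>conj (\<gamma> m)\<bar> \<le> \<bar>\<gamma> n\<bar> * (K * T (Suc n))"
    by (intro mult_left_mono) auto
  also have "\<dots> = (\<bar>\<gamma> n\<bar> * T (Suc n)) * K" by simp
  also have "\<dots> \<le> D * K" using \<gamma>_T_le K_nonneg by (intro mult_right_mono) auto
  finally show ?thesis .
qed

text \<open>Multiplying numerator and denominator of \<open>y (Suc n) = - \<gamma> n / \<gamma> (Suc n)\<close> by the conjugate of
  the denominator turns the denominator into an integer of bounded size, and the numerator into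
  an element of \<open>\<int>[\<beta>]\<close> that is bounded together with its conjugate.\<close>
lemma finite_complete_quotients: "finite (range y)"
proof -
  define A where "A = {z \<in> \<O>. \<bar>z\<bar> \<le> D * K \<and> \<bar>conj z\<bar> \<le> D * K}"
  define B where "B = {- \<lfloor>D * K\<rfloor>..\<lfloor>D * K\<rfloor>}"
  have "y (Suc n) \<in> (\<lambda>(z, m). - z / of_int m) ` (A \<times> B)" for n
  proof -
    define z where "z = \<gamma> n * conj (\<gamma> (Suc n))"
    obtain m :: int where m: "\<gamma> (Suc n) * conj (\<gamma> (Suc n)) = of_int m"
      using norm_int[OF \<gamma>_in_\<O>] .
    have cz: "conj z = conj (\<gamma> n) * \<gamma> (Suc n)"
      unfolding z_def by (simp add: conj_mult conj_in_\<O> \<gamma>_in_\<O>)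
    have "z \<in> \<O>" unfolding z_def by (intro mult_in_\<O> conj_in_\<O>(1) \<gamma>_in_\<O>)
    moreover have "\<bar>z\<bar> \<le> D * K" unfolding z_def abs_mult by (rule \<gamma>_conj_\<gamma>_le) simp
    moreover have "\<bar>conj z\<bar> \<le> D * K"
      unfolding cz abs_mult using \<gamma>_conj_\<gamma>_le[of n "Suc n"] by (simp add: mult.commute)
    ultimately have "z \<in> A" by (simp add: A_def)
    have "\<bar>real_of_int m\<bar> \<le> D * K"
      unfolding m[symmetric] abs_mult by (rule \<gamma>_conj_\<gamma>_le) simp
    then have "m \<in> B" unfolding B_def by (auto; linarith)
    have "conj (\<gamma> (Suc n)) \<noteq> 0" using conj_eq_0_iff[OF \<gamma>_in_\<O>] \<gamma>_nonzero by simp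
    then have "- z / of_int m = - \<gamma> n / \<gamma> (Suc n)"
      unfolding m[symmetric] z_def by simp
    also have "\<dots> = y (Suc n)"
      using \<gamma>_Suc[of n] \<gamma>_nonzero[of n] y_pos[of "Suc n"] by simp
    finally show ?thesis using \<open>z \<in> A\<close> \<open>m \<in> B\<close> by (intro image_eqI[of _ _ "(z, m)"]) auto
  qed
  then have "range y \<subseteq> insert (y 0) ((\<lambda>(z, m). - z / of_int m) ` (A \<times> B))"
    by (auto simp: image_iff) (metis not0_implies_Suc)
  moreover have "finite A" unfolding A_def by (rule finite_bounded_conjugates)
  ultimately show ?thesis by (elim finite_subset) (simp add: B_def)
qed

lemma finite_partial_quotients: "finite (range a)"
proof -
  have "a n \<in> (\<lambda>(s, t). s - 1 / t) ` (range y \<times> range y)" for n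
  proof -
    have "a n = y n - 1 / y (Suc n)" using y_step[of n] by simp
    then show ?thesis by (intro image_eqI[of _ _ "(y n, y (Suc n))"]) simp_all
  qed
  then have "range a \<subseteq> (\<lambda>(s, t). s - 1 / t) ` (range y \<times> range y)" by blast
  then show ?thesis by (rule finite_subset) (simp add: finite_complete_quotients)
qed

text \<open>The ratio is uniform because only finitely many partial quotients occur.\<close>
lemma uniform_strict_domination:
  obtains \<epsilon> where "\<epsilon> > 0" "\<epsilon> \<le> 1" "\<And>n. \<bar>conj (a n)\<bar> < a n \<Longrightarrow> \<bar>conj (a n)\<bar> \<le> (1 - \<epsilon>) * a n"
proof -
  define S where "S = insert 1 ((\<lambda>x. 1 - \<bar>conj x\<bar> / x) ` {x \<in> range a. \<bar>conj x\<bar> < x})"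
  have fin: "finite S" unfolding S_def using finite_partial_quotients by simp
  have pos: "s > 0" if "s \<in> S" for s using that by (auto simp: S_def divide_less_eq)
  show ?thesis
  proof (rule that[of "Min S"])
    show "Min S > 0" using fin pos by (subst Min_gr_iff) (auto simp: S_def)
    show "Min S \<le> 1" using fin by (intro Min_le) (auto simp: S_def)
    fix n assume n: "\<bar>conj (a n)\<bar> < a n"
    then have "a n > 0" by linarith
    have "Min S \<le> 1 - \<bar>conj (a n)\<bar> / a n" using fin n by (intro Min_le) (auto simp: S_def)
    then show "\<bar>conj (a n)\<bar> \<le> (1 - Min S) * a n" using \<open>a n > 0\<close> by (simp add: field_simps)
  qed
qed

text \<open>At a strictly dominated partial quotient the recursion of \<open>T\<close> gains a fixed proportion over
  the recursion of \<open>conj \<gamma>\<close>. The gain is passed on to the following index, so that it holds at two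
  consecutive indices and hence for ever.\<close>
lemma strict_domination_gain:
  assumes \<epsilon>: "0 < \<epsilon>" "\<epsilon> \<le> 1" "\<bar>conj (a (Suc j))\<bar> \<le> (1 - \<epsilon>) * a (Suc j)"
    and C: "C \<ge> 0" "\<And>n. n \<ge> j \<Longrightarrow> \<bar>conj (\<gamma> n)\<bar> \<le> C * T n"
    and n: "n \<ge> Suc (Suc j)"
  shows "\<bar>conj (\<gamma> n)\<bar> \<le> (1 - \<epsilon> / 4) * C * T n"
proof (rule conj_\<gamma>_majorant[OF _ _ n])
  \<comment> \<open>As \<open>a \<ge> 1\<close> and \<open>T\<close> increases, the term \<open>a * T\<close> makes up at least half of the next value of \<open>T\<close>.\<close>
  have half: "T (Suc (Suc i)) / 2 \<le> a (Suc i) * T (Suc i)" for i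
  proof -
    have "1 * T (Suc i) \<le> a (Suc i) * T (Suc i)"
      using a_ge_1[of i] T_ge_1[of "Suc i"] by (intro mult_right_mono) auto
    then have "T i \<le> a (Suc i) * T (Suc i)" using T_mono_Suc[of i] by simp
    then show ?thesis by (simp add: T_rec)
  qed
  have gain: "C * ((1 - \<delta>) * (a (Suc i) * T (Suc i)) + T i) \<le> (1 - \<delta> / 2) * C * T (Suc (Suc i))"
    if "\<delta> \<ge> 0" for i \<delta>
  proof -
    have "\<delta> * (T (Suc (Suc i)) / 2) \<le> \<delta> * (a (Suc i) * T (Suc i))"
      using half that by (rule mult_left_mono)
    then have "(1 - \<delta>) * (a (Suc i) * T (Suc i)) + T i \<le> (1 - \<delta> / 2) * T (Suc (Suc i))"
      unfolding T_rec by (simp add: algebra_simps)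
    then show ?thesis using C(1) by (metis mult.commute mult.assoc mult_left_mono)
  qed
  have "\<bar>conj (\<gamma> (Suc (Suc j)))\<bar> \<le> \<bar>conj (a (Suc j))\<bar> * \<bar>conj (\<gamma> (Suc j))\<bar> + \<bar>conj (\<gamma> j)\<bar>"
    unfolding conj_\<gamma>_rec by (metis abs_mult abs_triangle_ineq)
  also have "\<dots> \<le> ((1 - \<epsilon>) * a (Suc j)) * (C * T (Suc j)) + C * T j"
    using \<epsilon> C(2)[of j] C(2)[of "Suc j"] a_ge_1[of j] by (intro add_mono mult_mono) auto
  also have "\<dots> = C * ((1 - \<epsilon>) * (a (Suc j) * T (Suc j)) + T j)" by (simp add: algebra_simps)
  also have "\<dots> \<le> (1 - \<epsilon> / 2) * C * T (Suc (Suc j))" using \<epsilon>(1) by (intro gain) simp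
  finally have first: "\<bar>conj (\<gamma> (Suc (Suc j)))\<bar> \<le> (1 - \<epsilon> / 2) * C * T (Suc (Suc j))" .
  also have "\<dots> \<le> (1 - \<epsilon> / 4) * C * T (Suc (Suc j))"
    using \<epsilon>(1) C(1) T_ge_1[of "Suc (Suc j)"] by (intro mult_right_mono) auto
  finally show "\<bar>conj (\<gamma> (Suc (Suc j)))\<bar> \<le> (1 - \<epsilon> / 4) * C * T (Suc (Suc j))" .
  have "\<bar>conj (\<gamma> (Suc (Suc (Suc j))))\<bar>
      \<le> \<bar>conj (a (Suc (Suc j)))\<bar> * \<bar>conj (\<gamma> (Suc (Suc j)))\<bar> + \<bar>conj (\<gamma> (Suc j))\<bar>"
    unfolding conj_\<gamma>_rec[of "Suc j"] by (metis abs_mult abs_triangle_ineq)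
  also have "\<dots> \<le> a (Suc (Suc j)) * ((1 - \<epsilon> / 2) * C * T (Suc (Suc j))) + C * T (Suc j)"
    using first C(2)[of "Suc j"] a_ge_1[of "Suc j"] conj_a_le[of "Suc (Suc j)"]
    by (intro add_mono mult_mono) auto
  also have "\<dots> = C * ((1 - \<epsilon> / 2) * (a (Suc (Suc j)) * T (Suc (Suc j))) + T (Suc j))"
    by (simp add: algebra_simps)
  also have "\<dots> \<le> (1 - \<epsilon> / 2 / 2) * C * T (Suc (Suc (Suc j)))" using \<epsilon>(1) by (intro gain) simp
  finally show "\<bar>conj (\<gamma> (Suc (Suc (Suc j))))\<bar> \<le> (1 - \<epsilon> / 4) * C * T (Suc (Suc (Suc j)))"
    by simp
qed

text \<open>Infinitely many gains would make \<open>conj (\<gamma> n) / T n\<close> tend to zero, whereas the norm keeps it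
  above \<open>1 / D\<close>.\<close>
lemma finitely_many_strictly_dominated: "finite {n. \<bar>conj (a n)\<bar> < a n}"
proof (rule ccontr)
  assume inf: "\<not> ?thesis"
  obtain \<epsilon> where \<epsilon>: "\<epsilon> > 0" "\<epsilon> \<le> 1" "\<And>n. \<bar>conj (a n)\<bar> < a n \<Longrightarrow> \<bar>conj (a n)\<bar> \<le> (1 - \<epsilon>) * a n"
    using uniform_strict_domination by blast
  define \<rho> where "\<rho> = 1 - \<epsilon> / 4"
  have \<rho>: "0 \<le> \<rho>" "\<rho> < 1" using \<epsilon> by (auto simp: \<rho>_def)
  have decay: "\<exists>N. \<forall>n\<ge>N. \<bar>conj (\<gamma> n)\<bar> \<le> (\<rho> ^ k * K) * T n" for k
  proof (induction k)
    case 0 show ?case using conj_\<gamma>_le by auto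
  next
    case (Suc k)
    then obtain N where N: "\<And>n. n \<ge> N \<Longrightarrow> \<bar>conj (\<gamma> n)\<bar> \<le> (\<rho> ^ k * K) * T n" by blast
    obtain i where i: "i > N" "\<bar>conj (a i)\<bar> < a i"
      using inf unfolding finite_nat_set_iff_bounded_le by (auto simp: not_le)
    then obtain j where j: "i = Suc j" by (cases i) auto
    have "\<bar>conj (\<gamma> n)\<bar> \<le> (1 - \<epsilon> / 4) * (\<rho> ^ k * K) * T n" if "n \<ge> Suc (Suc j)" for n
      using \<epsilon> i j N K_nonneg \<rho>(1) that
      by (intro strict_domination_gain[where j = j]) auto
    then show ?case unfolding \<rho>_def[symmetric] by (auto simp: mult.assoc)
  qed
  have "(\<lambda>k. D * (\<rho> ^ k * K)) \<longlonglongrightarrow> D * (0 * K)"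
    using \<rho> by (intro tendsto_intros LIMSEQ_power_zero) auto
  then have "eventually (\<lambda>k. D * (\<rho> ^ k * K) < 1) sequentially"
    by (intro order_tendstoD(2)) auto
  then obtain k where k: "D * (\<rho> ^ k * K) < 1" by (auto simp: eventually_sequentially)
  obtain N where "\<bar>conj (\<gamma> N)\<bar> \<le> (\<rho> ^ k * K) * T N" using decay[of k] by blast
  then have "T N \<le> D * ((\<rho> ^ k * K) * T N)"
    using conj_\<gamma>_ge[of N] D_pos by (meson mult_left_mono order_less_imp_le order_trans)
  also have "\<dots> = (D * (\<rho> ^ k * K)) * T N" by simp
  also have "\<dots> < 1 * T N" using k T_ge_1[of N] by (intro mult_strict_right_mono) auto
  finally show False by simp
qed

end

section \<open>Expansions of elements of \<open>\<rat>(\<beta>)\<close>\<close>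

lemma finite_expansion_finite_indices:
  assumes "finite_bcf \<beta> \<xi>"
  shows "finite {n. \<exists>a. partial_quotient \<beta> \<xi> n = Some a \<and> P a}"
proof -
  obtain n0 where "complete_quotient \<beta> \<xi> n0 = None"
    using assms by (auto simp: finite_bcf_def partial_quotient_def)
  then have None: "complete_quotient \<beta> \<xi> (n0 + k) = None" for k
    by (induction k) auto
  have "n < n0" if "partial_quotient \<beta> \<xi> n = Some a" for n a
  proof (rule ccontr)
    assume "\<not> n < n0"
    then have "complete_quotient \<beta> \<xi> n = None" using None[of "n - n0"] by simp
    with that show False by (simp only: partial_quotient_def option.map option.distinct)
  qed
  then have "{n. \<exists>a. partial_quotient \<beta> \<xi> n = Some a \<and> P a} \<subseteq> {..<n0}" by blast
  then show ?thesis by (rule finite_subset) simp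
qed

context quadratic_perron_integer
begin

text \<open>The first partial quotient may be negative, so the theory of dominated continued fractions is
  applied from the second complete quotient on.\<close>
lemma infinite_expansion:
  assumes "\<xi> \<in> frac_\<O>" "\<not> finite_bcf \<beta> \<xi>"
  shows "finite (range (complete_quotient \<beta> \<xi>))"
    and "finite {n. \<exists>a. partial_quotient \<beta> \<xi> n = Some a \<and> a \<in> beta_integers \<beta> - \<int>}"
proof -
  define x where "x n = the (complete_quotient \<beta> \<xi> n)" for n
  have x: "complete_quotient \<beta> \<xi> n = Some (x n)" for n
    using assms(2) unfolding finite_bcf_def partial_quotient_def x_def
    by (metis option.exhaust_sel option.map_disc_iff)
  have x_step: "x n \<notin> beta_integers \<beta> \<and> x (Suc n) = 1 / (x n - beta_floor \<beta> (x n))" for n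
    using x[of "Suc n"] x[of n] by (auto split: if_splits)
  have floor_less: "beta_floor \<beta> (x n) < x n" for n
    using beta_floor_le[of "x n"] beta_floor_in[of "x n"] x_step[of n] by (metis order_le_less)
  define y where "y n = x (Suc n)" for n
  define a where "a n = beta_floor \<beta> (y n)" for n
  have y_pos: "y n > 0" for n
    using x_step[of n] floor_less[of n] by (simp add: y_def)
  have "y n \<noteq> a n" for n
    using floor_less[of "Suc n"] by (simp add: y_def a_def)
  then have y_step: "y n = a n + 1 / y (Suc n)" for n
    using x_step[of "Suc n"] by (simp add: y_def a_def)
  have a_nonneg: "a n \<ge> 0" for n
    using beta_floor_greatest[OF beta_integers_0_1(1)[OF base_gt_1]] y_pos[of n] by (simp add: a_def)
  \<comment> \<open>Nonnegative numbers lie less than 1 above their floor, so the next complete quotient exceeds the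
     \<open>\<beta>\<close>-integer 1.\<close>
  have a_ge_1: "a (Suc n) \<ge> 1" for n
  proof -
    have "y n - a n < 1" "y n - a n > 0"
      using beta_floor_gap[of "y n"] y_pos[of n] floor_less[of "Suc n"] by (simp_all add: a_def y_def)
    then have "1 \<le> 1 / (y n - a n)" by simp
    also have "1 / (y n - a n) = y (Suc n)"
      using x_step[of "Suc n"] by (simp add: y_def a_def)
    finally show ?thesis
      using beta_floor_greatest[OF beta_integers_0_1(2)[OF base_gt_1]] by (simp add: a_def)
  qed
  have a_beta: "a n \<in> beta_integers \<beta>" for n unfolding a_def by (rule beta_floor_in)
  have "y 0 = inverse (\<xi> + - beta_floor \<beta> \<xi>)"
    using x_step[of 0] x[of 0] by (simp add: y_def divide_inverse)
  also have "\<dots> \<in> frac_\<O>"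
    using subfield_frac_\<O> assms(1) \<O>_subset_frac[OF beta_integer_in_\<O>[OF beta_floor_in[of \<xi>]]]
    unfolding is_subfield_def by blast
  finally obtain u d where u: "u \<in> \<O>" "d > 0" "y 0 = u / of_int d"
    by (rule frac_\<O>_cases)
  have conj_a_le: "\<bar>conj (a n)\<bar> \<le> a n" for n
    using beta_integer_conj_le[OF a_beta[of n]] a_nonneg[of n] by simp
  interpret dominated_continued_fraction \<beta> b c a y u d
    by unfold_locales (fact beta_integer_in_\<O>[OF a_beta] conj_a_le a_ge_1 y_pos y_step u)+
  have "complete_quotient \<beta> \<xi> n \<in> insert (Some \<xi>) (Some ` range y)" for n
    by (cases n) (auto simp: x y_def simp del: complete_quotient.simps(2))
  then have "range (complete_quotient \<beta> \<xi>) \<subseteq> insert (Some \<xi>) (Some ` range y)" by blast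
  then show "finite (range (complete_quotient \<beta> \<xi>))"
    by (rule finite_subset) (simp add: finite_complete_quotients)
  have "n \<in> insert 0 (Suc ` {n. \<bar>conj (a n)\<bar> < a n})"
    if "partial_quotient \<beta> \<xi> n = Some z" "z \<in> beta_integers \<beta> - \<int>" for n z
  proof (cases n)
    case (Suc m)
    then have "z = a m" using that(1) x[of n] by (simp add: partial_quotient_def a_def y_def)
    then have "\<bar>conj (a m)\<bar> < a m"
      using that(2) beta_integer_conj_less[of z] a_nonneg[of m] by simp
    then show ?thesis using Suc by simp
  qed simp
  then have "{n. \<exists>a. partial_quotient \<beta> \<xi> n = Some a \<and> a \<in> beta_integers \<beta> - \<int>}
      \<subseteq> insert 0 (Suc ` {n. \<bar>conj (a n)\<bar> < a n})" by blast
  then show "finite {n. \<exists>a. partial_quotient \<beta> \<xi> n = Some a \<and> a \<in> beta_integers \<beta> - \<int>}"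
    by (rule finite_subset) (simp add: finitely_many_strictly_dominated)
qed

end

text \<open>Each complete quotient determines the next one, so one coincidence gives periodicity.\<close>
lemma complete_quotient_periodic:
  assumes "complete_quotient \<beta> \<xi> (i + p) = complete_quotient \<beta> \<xi> i" "n \<ge> i"
  shows "complete_quotient \<beta> \<xi> (n + p) = complete_quotient \<beta> \<xi> n"
proof -
  have "complete_quotient \<beta> \<xi> (i + k + p) = complete_quotient \<beta> \<xi> (i + k)" for k
  proof (induction k)
    case 0 show ?case using assms(1) by simp
  next
    case (Suc k)
    then show ?case by (simp only: add_Suc add_Suc_right complete_quotient.simps)
  qed
  from this[of "n - i"] show ?thesis using assms(2) by simp
qed

lemma quadratic_perron_imp_locale:
  assumes "quadratic_perron \<beta>"
  obtains b c where "quadratic_perron_integer \<beta> b c"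
proof -
  obtain p where p: "lead_coeff p = 1" "irreducible p" "poly (map_poly of_rat p) \<beta> = 0" "degree p = 2"
    and conjugates: "\<And>\<beta>'::complex. poly (map_poly of_rat p) \<beta>' = 0 \<Longrightarrow> \<beta>' \<noteq> of_real \<beta> \<Longrightarrow> norm \<beta>' < \<beta>"
    and "\<beta> > 1" "algebraic_int \<beta>"
    using assms by (auto simp: quadratic_perron_def is_min_poly_def)
  have irrational: "\<beta> \<notin> \<rat>"
    using irreducible_quadratic_root_irrational p by blast
  have coeff: "coeff p (Suc (Suc 0)) = 1" using p(1,4) by (simp add: numeral_2_eq_2)
  have poly_p: "poly (map_poly of_rat p) z = of_rat (coeff p 0) + of_rat (coeff p 1) * z + z\<^sup>2"
    for z :: "'a :: field_char_0"
    using p(4) coeff by (simp add: poly_altdef degree_map_poly coeff_map_poly numeral_2_eq_2)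
  have "\<beta>\<^sup>2 = of_rat (- coeff p 1) * \<beta> + of_rat (- coeff p 0)"
    using p(3) unfolding poly_p by (simp add: of_rat_minus algebra_simps)
  then obtain b c :: int where bc: "- coeff p 1 = of_int b" "- coeff p 0 = of_int c"
    using quadratic_algebraic_int_equation \<open>algebraic_int \<beta>\<close> irrational by metis
  have pb: "poly (map_poly of_rat p) z = z\<^sup>2 - of_int b * z - of_int c" for z :: "'a :: field_char_0"
  proof -
    have "coeff p 1 = of_int (- b)" "coeff p 0 = of_int (- c)" using bc by (simp_all add: minus_equation_iff)
    then show ?thesis unfolding poly_p by (simp add: of_rat_minus)
  qed
  interpret quadratic_integer \<beta> b c
    using irrational p(3) pb[of \<beta>] by unfold_locales simp_all
  have "poly (map_poly of_rat p) (of_real \<beta>' :: complex) = of_real (\<beta>'\<^sup>2 - of_int b * \<beta>' - of_int c)"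
    unfolding pb by simp
  also have "\<dots> = 0" using equation' by simp
  finally have "norm (of_real \<beta>' :: complex) < \<beta>"
    using conjugates conjugates_distinct by (metis of_real_eq_iff)
  then have "quadratic_perron_integer \<beta> b c"
    using \<open>\<beta> > 1\<close> by unfold_locales simp_all
  then show ?thesis by (rule that)
qed

theorem theorem6p4:
  fixes \<beta> :: real
  assumes "quadratic_perron \<beta>"
  shows "(\<forall>\<xi>\<in>rat_adjoin \<beta>.
            finite {n. \<exists>a. partial_quotient \<beta> \<xi> n = Some a \<and> a \<in> beta_integers \<beta> - \<int>} \<and>
            (finite_bcf \<beta> \<xi> \<or>
             (\<exists>N p. bcf_periodic_from \<beta> \<xi> N p \<and>
                (\<forall>n\<in>{N..<N + p}. \<exists>a\<in>\<int>. partial_quotient \<beta> \<xi> n = Some a))))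
         \<and> CFP \<beta>"
proof -
  obtain b c where "quadratic_perron_integer \<beta> b c"
    using quadratic_perron_imp_locale[OF assms] .
  then interpret quadratic_perron_integer \<beta> b c .
  let ?bad = "\<lambda>\<xi>. {n. \<exists>a. partial_quotient \<beta> \<xi> n = Some a \<and> a \<in> beta_integers \<beta> - \<int>}"
  have finite_bad: "finite (?bad \<xi>)" if "\<xi> \<in> rat_adjoin \<beta>" for \<xi>
  proof (cases "finite_bcf \<beta> \<xi>")
    case True
    then show ?thesis by (rule finite_expansion_finite_indices)
  next
    case False
    then show ?thesis using infinite_expansion(2) that rat_adjoin_subset by blast
  qed
  have periodic: "\<exists>N p. bcf_periodic_from \<beta> \<xi> N p \<and>
      (\<forall>n\<in>{N..<N + p}. \<exists>a\<in>\<int>. partial_quotient \<beta> \<xi> n = Some a)"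
    if \<xi>: "\<xi> \<in> rat_adjoin \<beta>" and inf: "\<not> finite_bcf \<beta> \<xi>" for \<xi>
  proof -
    have "\<not> inj (complete_quotient \<beta> \<xi>)"
      using infinite_expansion(1)[of \<xi>] \<xi> inf rat_adjoin_subset finite_imageD[of _ UNIV] by auto
    then obtain i j where "i < j" "complete_quotient \<beta> \<xi> j = complete_quotient \<beta> \<xi> i"
      unfolding inj_def by (metis linorder_neqE_nat)
    then obtain p where p: "p > 0" "complete_quotient \<beta> \<xi> (i + p) = complete_quotient \<beta> \<xi> i"
      using less_imp_add_positive by blast
    obtain M where M: "\<And>n. n \<in> ?bad \<xi> \<Longrightarrow> n \<le> M"
      using finite_bad[OF \<xi>] finite_nat_set_iff_bounded_le by auto
    \<comment> \<open>From \<open>N\<close> on the expansion is periodic and beyond all partial quotients outside \<open>\<int>\<close>.\<close>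
    define N where "N = max i (Suc M)"
    have "bcf_periodic_from \<beta> \<xi> N p"
      unfolding bcf_periodic_from_def partial_quotient_def N_def
      using inf p complete_quotient_periodic[OF p(2)] by simp
    moreover have "\<exists>a\<in>\<int>. partial_quotient \<beta> \<xi> n = Some a" if "n \<ge> N" for n
    proof -
      obtain x where x: "complete_quotient \<beta> \<xi> n = Some x"
        using inf by (auto simp: finite_bcf_def partial_quotient_def)
      then have pq: "partial_quotient \<beta> \<xi> n = Some (beta_floor \<beta> x)"
        by (simp add: partial_quotient_def)
      have "n \<notin> ?bad \<xi>" using M[of n] that by (auto simp: N_def)
      then show ?thesis using pq beta_floor_in by auto
    qed
    ultimately show ?thesis by (meson atLeastLessThan_iff)
  qed
  show ?thesis unfolding CFP_def using finite_bad periodic by blast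
qed

end
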